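(* Every MILP-representable set $S\subseteq\mathbb{R}^N$ is a mixed-integer Chvátal (MIC) set.
   Context: $\mathbb{Q}_+$ denotes the nonnegative rationals, and $\lceil a\rceil$ the smallest integer no less than $a\in\mathbb{R}$. MILP-representable. A set $S\subseteq\mathbb{R}^N$ is MILP-representable if there exist $p,r\ge 0$, rational matrices $A,B,C$ and a rational vector $d$ such that $S=\{x\in\mathbb{R}^N : \exists\, y\in\mathbb{R}^p,\ w\in\mathbb{Z}^r \text{ with } Ax+By+Cw\ge d\}$. Affine Chvátal functions. An affine Chvátal function $f:\mathbb{R}^N\to\mathbb{R}$ is a function represented by a finite rooted binary tree in which each node is either (i) a leaf, which corresponds to an affine linear function on $\mathbb{R}^N$ with rational coefficients (including a rational constant term); (ii) a node with one child, the edge to the child being labeled either by $\lceil\cdot\rceil$ or by a number in $\mathbb{Q}_+$; or (iii) a node with two children, each edge being labeled by a number in $\mathbb{Q}_+$. The function is defined recursively from the root: a tree consisting of a single leaf represents the affine function of that leaf; if the root has a single child whose subtree represents $g$, then $f=\lceil g\rceil$ if the edge is labeled $\lceil\cdot\rceil$, and $f=\alpha g$ if it is labeled $\alpha\in\mathbb{Q}_+$; if the root has two children whose subtrees represent $g$ and $h$, with edges labeled $\alpha,\beta\in\mathbb{Q}_+$ respectively, then $f=\alpha g+\beta h$. MIC sets. A set $S\subseteq\mathbb{R}^N$ is a mixed-integer Chvátal (MIC) set if there exist integers $n,q\ge 0$ with $n+q=N$, finitely many affine Chvátal functions $f_1,\dots,f_m:\mathbb{R}^{n+q}\to\mathbb{R}$,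 and $b_1,\dots,b_m\in\mathbb{R}$ such that $S=\{(x,z)\in\mathbb{R}^n\times\mathbb{Z}^q : f_i(x,z)\le b_i \text{ for } i=1,\dots,m\}$. *)

theory Defs
  imports Complex_Main "Jordan_Normal_Form.Matrix"
begin

text \<open>\<open>\<real>\<^sup>N\<close> is \<open>carrier_vec N\<close> at type \<open>real vec\<close>, and \<open>\<le>\<close> on vectors is the componentwise order.\<close>

abbreviation real_of_rat_mat :: "rat mat \<Rightarrow> real mat" where
  "real_of_rat_mat \<equiv> map_mat real_of_rat"

abbreviation real_of_rat_vec :: "rat vec \<Rightarrow> real vec" where
  "real_of_rat_vec \<equiv> map_vec real_of_rat"

abbreviation real_of_int_vec :: "int vec \<Rightarrow> real vec" where
  "real_of_int_vec \<equiv> map_vec real_of_int"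

definition milp_representable :: "nat \<Rightarrow> real vec set \<Rightarrow> bool" where
  "milp_representable N S \<longleftrightarrow>
    (\<exists>p r k. \<exists>A \<in> carrier_mat k N. \<exists>B \<in> carrier_mat k p. \<exists>C \<in> carrier_mat k r. \<exists>d \<in> carrier_vec k.
      S = {x \<in> carrier_vec N. \<exists>y \<in> carrier_vec p. \<exists>w \<in> carrier_vec r.
            real_of_rat_mat A *\<^sub>v x + real_of_rat_mat B *\<^sub>v y
              + real_of_rat_mat C *\<^sub>v real_of_int_vec w \<ge> real_of_rat_vec d})"

text \<open>The numbers stored in a tree are the edge labels: the label of an edge is
  kept immediately before the subtree that the edge leads to. \<open>Leaf a c\<close> is the affine
  function \<open>x \<mapsto> a \<bullet> x + c\<close>. Nonnegativity of the labels and the dimension of the leaves are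
  imposed by \<open>chvatal_tree_on\<close>.\<close>

datatype chvatal_tree =
    Leaf "rat vec" rat
  | Ceil chvatal_tree
  | Scale rat chvatal_tree
  | Comb rat chvatal_tree rat chvatal_tree

fun chvatal_tree_on :: "nat \<Rightarrow> chvatal_tree \<Rightarrow> bool" where
  "chvatal_tree_on N (Leaf a c) \<longleftrightarrow> a \<in> carrier_vec N"
| "chvatal_tree_on N (Ceil t) \<longleftrightarrow> chvatal_tree_on N t"
| "chvatal_tree_on N (Scale \<alpha> t) \<longleftrightarrow> \<alpha> \<ge> 0 \<and> chvatal_tree_on N t"
| "chvatal_tree_on N (Comb \<alpha> t \<beta> u) \<longleftrightarrow>
     \<alpha> \<ge> 0 \<and> \<beta> \<ge> 0 \<and> chvatal_tree_on N t \<and> chvatal_tree_on N u"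

fun chvatal_fun :: "chvatal_tree \<Rightarrow> real vec \<Rightarrow> real" where
  "chvatal_fun (Leaf a c) x = real_of_rat_vec a \<bullet> x + real_of_rat c"
| "chvatal_fun (Ceil t) x = real_of_int \<lceil>chvatal_fun t x\<rceil>"
| "chvatal_fun (Scale \<alpha> t) x = real_of_rat \<alpha> * chvatal_fun t x"
| "chvatal_fun (Comb \<alpha> t \<beta> u) x =
     real_of_rat \<alpha> * chvatal_fun t x + real_of_rat \<beta> * chvatal_fun u x"

text \<open>Functions on \<open>\<real>\<^sup>N\<close> are total functions on \<open>real vec\<close>, of which only the values on
  \<open>carrier_vec N\<close> matter.\<close>

definition affine_chvatal :: "nat \<Rightarrow> (real vec \<Rightarrow> real) \<Rightarrow> bool" where
  "affine_chvatal N f \<longleftrightarrow>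
    (\<exists>t. chvatal_tree_on N t \<and> (\<forall>x \<in> carrier_vec N. f x = chvatal_fun t x))"

definition mic_set :: "nat \<Rightarrow> real vec set \<Rightarrow> bool" where
  "mic_set N S \<longleftrightarrow>
    (\<exists>n q m (f :: nat \<Rightarrow> real vec \<Rightarrow> real) (b :: nat \<Rightarrow> real).
      n + q = N \<and> (\<forall>i<m. affine_chvatal (n + q) (f i)) \<and>
      S = {x @\<^sub>v real_of_int_vec z | x z.
            x \<in> carrier_vec n \<and> z \<in> carrier_vec q \<and>
            (\<forall>i<m. f i (x @\<^sub>v real_of_int_vec z) \<le> b i)})"

end

theory Submission
  imports Defs
begin

text \<open>
  The integer variables can be eliminated completely, so no integer coordinate has to be kept in
  the MIC description: all the variables are continuous and the right-hand sides are \<open>0\<close>.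

  Write an inequality \<open>a \<cdot> w \<ge> F x\<close> in the existential variables \<open>w\<close>, with the parameter \<open>x\<close>
  on the right, as a cut \<open>(a, F)\<close>. From valid cuts, nonnegative rational combinations produce
  valid cuts, and if \<open>a\<close> is integral and \<open>w\<close> ranges over integer points then \<open>F\<close> may be rounded
  up. Exactly these operations build Chvatal functions. A derived cut with \<open>a = 0\<close> reads
  \<open>F x \<le> 0\<close> and mentions only \<open>x\<close>. So it suffices to find finitely many derived
  cuts with \<open>a = 0\<close> that detect, uniformly in \<open>x\<close>, every infeasible system.

  Over the reals, Fourier-Motzkin elimination does this (\<open>fourier_motzkin\<close>), and it also removes
  the continuous variables \<open>y\<close> at the start. Over the integers the proof is by induction on the
  number of variables (\<open>integer_elimination\<close>). If a system is feasible over the reals but not over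
  the integers, then some row \<open>c \<cdot> w \<ge> G x\<close> has slack bounded, on the whole polyhedron, by a number
  \<open>K\<close> that depends only on the coefficients: otherwise the average of points with large slack in
  the single rows has large slack in all rows, and rounding it down gives an integer solution
  (\<open>rounding\<close>). On the other hand the lower bound of that row can be raised step by step. A
  hyperplane \<open>c \<cdot> w = L x\<close> that contains no integer solution is refuted by the induction
  hypothesis in one dimension less, and that refutation lifts to a cut \<open>c \<cdot> w \<ge> L' x\<close> of the
  original family with \<open>L' x > L x\<close> (\<open>raise_bound\<close>). After boundedly many steps the bound exceeds
  the maximum of \<open>c \<cdot> w\<close>, and the real case finishes the refutation. Which row is thin depends on
  \<open>x\<close>, but there are only finitely many rows and all numbers of steps are independent of \<open>x\<close>, so
  the set of cuts collected over all cases is finite.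
\<close>

section \<open>Cuts and families closed under Chvatal operations\<close>

definition lin :: "nat \<Rightarrow> (nat \<Rightarrow> rat) \<Rightarrow> (nat \<Rightarrow> real) \<Rightarrow> real" where
  "lin n a w = (\<Sum>j<n. of_rat (a j) * w j)"

text \<open>
  A cut \<open>(a, F)\<close> stands for the inequality \<open>F x \<le> lin n a w\<close> in the variables \<open>w\<close>, whose right-hand
  side depends on a parameter \<open>x\<close>. Only the first \<open>n\<close> coefficients matter; the dimension \<open>n\<close> is
  supplied from outside, so that coordinates can be added and dropped without retyping.
\<close>
type_synonym 'x cut = "(nat \<Rightarrow> rat) \<times> ('x \<Rightarrow> real)"

definition sat :: "nat \<Rightarrow> 'x cut set \<Rightarrow> 'x \<Rightarrow> (nat \<Rightarrow> real) \<Rightarrow> bool" where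
  "sat n sys x w \<longleftrightarrow> (\<forall>(a, F)\<in>sys. F x \<le> lin n a w)"

lemma satD: "sat n sys x w \<Longrightarrow> (a, F) \<in> sys \<Longrightarrow> F x \<le> lin n a w"
  by (auto simp: sat_def)

lemma sat_memD: "sat n sys x w \<Longrightarrow> s \<in> sys \<Longrightarrow> snd s x \<le> lin n (fst s) w"
  by (cases s) (simp add: satD)

definition int_sat :: "nat \<Rightarrow> 'x cut set \<Rightarrow> 'x \<Rightarrow> bool" where
  "int_sat n sys x \<longleftrightarrow> (\<exists>w. (\<forall>j. w j \<in> \<int>) \<and> sat n sys x w)"

definition integral :: "nat \<Rightarrow> (nat \<Rightarrow> rat) \<Rightarrow> bool" where
  "integral n a \<longleftrightarrow> (\<forall>j<n. a j \<in> \<int>)"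

definition comb_closed :: "'x cut set \<Rightarrow> bool" where
  "comb_closed D \<longleftrightarrow> (\<forall>a F b G \<alpha> \<beta>. (a, F) \<in> D \<longrightarrow> (b, G) \<in> D \<longrightarrow> \<alpha> \<ge> 0 \<longrightarrow> \<beta> \<ge> 0 \<longrightarrow>
     ((\<lambda>j. \<alpha> * a j + \<beta> * b j), (\<lambda>x. of_rat \<alpha> * F x + of_rat \<beta> * G x)) \<in> D)"

definition ceil_closed :: "nat \<Rightarrow> 'x cut set \<Rightarrow> bool" where
  "ceil_closed n D \<longleftrightarrow> (\<forall>a F. (a, F) \<in> D \<longrightarrow> integral n a \<longrightarrow> (a, (\<lambda>x. of_int \<lceil>F x\<rceil>)) \<in> D)"

lemma comb_closedD:
  assumes "comb_closed D" "(a, F) \<in> D" "(b, G) \<in> D" "\<alpha> \<ge> 0" "\<beta> \<ge> 0"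
    and "\<And>j. c j = \<alpha> * a j + \<beta> * b j" "\<And>x. H x = of_rat \<alpha> * F x + of_rat \<beta> * G x"
  shows "(c, H) \<in> D"
proof -
  have "c = (\<lambda>j. \<alpha> * a j + \<beta> * b j)" "H = (\<lambda>x. of_rat \<alpha> * F x + of_rat \<beta> * G x)"
    using assms by auto
  then show ?thesis using assms(1-5) unfolding comb_closed_def by blast
qed

lemma scale_closedD:
  assumes "comb_closed D" "(a, F) \<in> D" "\<alpha> \<ge> 0"
    and "\<And>j. c j = \<alpha> * a j" "\<And>x. H x = of_rat \<alpha> * F x"
  shows "(c, H) \<in> D"
  by (rule comb_closedD[OF assms(1,2,2,3), of 0]) (use assms in auto)

lemma ceil_closedD:
  assumes "ceil_closed n D" "(a, F) \<in> D" "integral n a" "\<And>x. H x = of_int \<lceil>F x\<rceil>"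
  shows "(a, H) \<in> D"
proof -
  have "H = (\<lambda>x. of_int \<lceil>F x\<rceil>)" using assms by auto
  then show ?thesis using assms(1-3) unfolding ceil_closed_def by blast
qed

lemma lin_cong:
  assumes "\<And>j. j < n \<Longrightarrow> a j = b j" "\<And>j. j < n \<Longrightarrow> v j = w j"
  shows "lin n a v = lin n b w"
  using assms by (simp add: lin_def)

lemma lin_Suc: "lin (Suc n) a w = lin n a w + of_rat (a n) * w n"
  by (simp add: lin_def)

lemma lin_comb:
  "lin n (\<lambda>j. \<alpha> * a j + \<beta> * b j) w = of_rat \<alpha> * lin n a w + of_rat \<beta> * lin n b w"
  by (simp add: lin_def of_rat_add of_rat_mult sum.distrib sum_distrib_left algebra_simps)

lemma lin_scale: "lin n (\<lambda>j. \<alpha> * a j) w = of_rat \<alpha> * lin n a w"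
  using lin_comb[of n \<alpha> a 0 a w] by simp

lemma lin_zero: "(\<And>j. j < n \<Longrightarrow> a j = 0) \<Longrightarrow> lin n a w = 0"
  by (simp add: lin_def)

lemma lin_diff: "lin n a (\<lambda>j. v j - w j) = lin n a v - lin n a w"
  by (simp add: lin_def sum_subtractf algebra_simps)

lemma lin_average:
  "lin n a (\<lambda>j. (\<Sum>s\<in>A. W s j) / m) = (\<Sum>s\<in>A. lin n a (W s)) / m"
  unfolding lin_def
  by (simp add: sum_divide_distrib sum_distrib_left sum_distrib_right sum.swap[of _ A])

lemma abs_lin_le:
  assumes "\<And>j. \<bar>w j\<bar> \<le> 1"
  shows "\<bar>lin n a w\<bar> \<le> of_rat (\<Sum>j<n. \<bar>a j\<bar>)"
proof -
  have "\<bar>lin n a w\<bar> \<le> (\<Sum>j<n. \<bar>of_rat (a j) * w j\<bar>)"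
    unfolding lin_def by (rule sum_abs)
  also have "\<dots> \<le> (\<Sum>j<n. of_rat \<bar>a j\<bar>)"
    by (rule sum_mono) (use assms in \<open>auto simp: abs_mult intro!: mult_left_le\<close>)
  finally show ?thesis by (simp add: of_rat_sum)
qed

lemma lin_Ints:
  assumes "integral n a" "\<And>j. w j \<in> \<int>"
  shows "lin n a w \<in> \<int>"
  unfolding lin_def
proof (rule Ints_sum)
  fix j assume "j \<in> {..<n}"
  then obtain z where "a j = of_int z" using assms(1) by (auto simp: integral_def elim: Ints_cases)
  then show "of_rat (a j) * w j \<in> \<int>" using assms(2) by simp
qed

section \<open>Real feasibility and rounding\<close>

lemma between_finite_sets:
  fixes A B :: "real set"
  assumes "finite A" "finite B" "\<And>a b. a \<in> A \<Longrightarrow> b \<in> B \<Longrightarrow> a \<le> b"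
  shows "\<exists>t. (\<forall>a\<in>A. a \<le> t) \<and> (\<forall>b\<in>B. t \<le> b)"
proof (cases "A = {}")
  case True
  show ?thesis
  proof (cases "B = {}")
    case False
    then have "\<forall>b\<in>B. Min B \<le> b" using assms by auto
    then show ?thesis using True by blast
  qed (use True in auto)
next
  case False
  then have "\<forall>a\<in>A. a \<le> Max A" "\<forall>b\<in>B. Max A \<le> b" using assms by auto
  then show ?thesis by blast
qed

lemma cross_multiply_le:
  fixes p q a b c d :: real
  assumes "p > 0" "q < 0" "- q * a + p * b \<le> - q * c + p * d"
  shows "(a - c) / p \<le> (b - d) / q"
proof -
  have "(b - d) * p \<le> (a - c) * q" using assms(3) by (simp add: algebra_simps)
  then show ?thesis using assms(1,2) by (simp add: divide_simps)
qed

text \<open>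
  Each elimination step replaces the rows by those not containing the last variable and by the
  positive combinations of a row with positive and a row with negative last coefficient in which
  that variable cancels. The family of all cuts in \<open>D\<close> with vanishing last coefficient is again
  closed under combinations, so the induction stays inside \<open>D\<close>.
\<close>
lemma fourier_motzkin:
  fixes D :: "'x cut set"
  assumes "comb_closed D" "finite sys" "sys \<subseteq> D"
  shows "\<exists>R. finite R \<and> R \<subseteq> D \<and> (\<forall>(a, F)\<in>R. \<forall>j<n. a j = 0) \<and>
           (\<forall>x. (\<forall>(a, F)\<in>R. F x \<le> 0) \<longrightarrow> (\<exists>w. sat n sys x w))"
  using assms
proof (induction n arbitrary: D sys)
  case 0
  show ?case
    by (rule exI[of _ sys]) (use 0 in \<open>auto simp: sat_def lin_def\<close>)
next
  case (Suc n)
  let ?P = "{s\<in>sys. fst s n > 0}" and ?N = "{s\<in>sys. fst s n < 0}" and ?Z = "{s\<in>sys. fst s n = 0}"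
  define mix :: "'x cut \<times> 'x cut \<Rightarrow> 'x cut" where "mix = (\<lambda>(s, t).
     ((\<lambda>j. - fst t n * fst s j + fst s n * fst t j),
      (\<lambda>x. of_rat (- fst t n) * snd s x + of_rat (fst s n) * snd t x)))"
  define D' where "D' = {s\<in>D. fst s n = 0}"
  have D': "comb_closed D'"
    using Suc.prems(1) unfolding comb_closed_def D'_def by auto
  have mixD: "mix (s, t) \<in> D'" if "s \<in> ?P" "t \<in> ?N" for s t
  proof -
    have "mix (s, t) \<in> D" unfolding mix_def split_conv
      by (rule comb_closedD[OF Suc.prems(1), of "fst s" "snd s" "fst t" "snd t"])
        (use that Suc.prems in auto)
    then show ?thesis by (simp add: D'_def mix_def)
  qed
  let ?sys = "?Z \<union> mix ` (?P \<times> ?N)"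
  have "finite ?sys" "?sys \<subseteq> D'"
    using Suc.prems(2,3) mixD by (auto simp: D'_def)
  from Suc.IH[OF D' this] obtain R where R: "finite R" "R \<subseteq> D'" "\<forall>(a, F)\<in>R. \<forall>j<n. a j = 0"
      "\<And>x. \<forall>(a, F)\<in>R. F x \<le> 0 \<Longrightarrow> \<exists>w. sat n ?sys x w" by blast
  show ?case
  proof (intro exI[of _ R] conjI allI impI)
    show "\<forall>(a, F)\<in>R. \<forall>j<Suc n. a j = 0"
      using R(2,3) by (fastforce simp: D'_def less_Suc_eq)
    fix x assume "\<forall>(a, F)\<in>R. F x \<le> 0"
    from R(4)[OF this] obtain w where w: "sat n ?sys x w" by blast
    define bnd where "bnd s = (snd s x - lin n (fst s) w) / of_rat (fst s n)" for s :: "'x cut"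
    have "\<exists>t. (\<forall>a\<in>bnd ` ?P. a \<le> t) \<and> (\<forall>b\<in>bnd ` ?N. t \<le> b)"
    proof (rule between_finite_sets)
      fix a b assume "a \<in> bnd ` ?P" "b \<in> bnd ` ?N"
      then obtain s t where s: "s \<in> ?P" "a = bnd s" and t: "t \<in> ?N" "b = bnd t" by blast
      have "mix (s, t) \<in> ?sys" using s t by blast
      from sat_memD[OF w this] have "of_rat (- fst t n) * snd s x + of_rat (fst s n) * snd t x
          \<le> of_rat (- fst t n) * lin n (fst s) w + of_rat (fst s n) * lin n (fst t) w"
        unfolding mix_def split_conv fst_conv snd_conv lin_comb .
      moreover have "of_rat (fst s n) > (0::real)" "of_rat (fst t n) < (0::real)" using s t by auto
      ultimately show "a \<le> b" unfolding s(2) t(2) bnd_def of_rat_minus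
        by (intro cross_multiply_le)
    qed (use Suc.prems in auto)
    then obtain t where bnds: "\<forall>a\<in>bnd ` ?P. a \<le> t" "\<forall>b\<in>bnd ` ?N. t \<le> b" by (elim exE conjE)
    note t = bspec[OF bnds(1) imageI] bspec[OF bnds(2) imageI]
    have "sat (Suc n) sys x (w(n := t))"
      unfolding sat_def
    proof (intro ballI, clarify)
      fix a F assume s: "(a, F) \<in> sys"
      have eq: "lin (Suc n) a (w(n := t)) = lin n a w + of_rat (a n) * t"
        by (auto simp: lin_Suc intro!: lin_cong)
      consider "a n = 0" | "a n > 0" | "a n < 0" by linarith
      then show "F x \<le> lin (Suc n) a (w(n := t))"
      proof cases
        case 1
        then have "(a, F) \<in> ?sys" using s by auto
        from satD[OF w this] show ?thesis using 1 unfolding eq by simp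
      next
        case 2
        then have pos: "of_rat (a n) > (0::real)" by simp
        have "(F x - lin n a w) / of_rat (a n) \<le> t"
          using t(1)[of "(a, F)"] s 2 by (simp add: bnd_def)
        with pos show ?thesis unfolding eq by (simp add: pos_divide_le_eq mult.commute)
      next
        case 3
        then have neg: "of_rat (a n) < (0::real)" by simp
        have "t \<le> (F x - lin n a w) / of_rat (a n)"
          using t(2)[of "(a, F)"] s 3 by (simp add: bnd_def)
        with neg show ?thesis unfolding eq by (simp add: neg_le_divide_eq mult.commute)
      qed
    qed
    then show "\<exists>w. sat (Suc n) sys x w" by blast
  qed (use R in \<open>auto simp: D'_def\<close>)
qed

text \<open>
  Rounding down the coordinates of a real point changes a row by at most the sum of the absolute
  values of its coefficients. The average of \<open>card sys\<close> feasible points, of which the one belonging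
  to a row has \<open>card sys\<close> times that slack in this row, leaves just enough room in every row.
\<close>
lemma rounding:
  fixes sys :: "'x cut set"
  assumes "finite sys"
    and wide: "\<And>a F. (a, F) \<in> sys \<Longrightarrow>
      \<exists>w. sat n sys x w \<and> F x + real (card sys) * of_rat (\<Sum>j<n. \<bar>a j\<bar>) \<le> lin n a w"
  shows "int_sat n sys x"
proof (cases "sys = {}")
  case True
  then show ?thesis unfolding int_sat_def sat_def by (intro exI[of _ "\<lambda>_. 0"]) auto
next
  case False
  define k where "k = real (card sys)"
  have k: "k > 0" using False assms(1) by (simp add: k_def card_gt_0_iff)
  have "\<forall>s\<in>sys. \<exists>w. sat n sys x w \<and> snd s x + k * of_rat (\<Sum>j<n. \<bar>fst s j\<bar>) \<le> lin n (fst s) w"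
    using wide by (auto simp: k_def)
  then obtain W where W: "\<And>s. s \<in> sys \<Longrightarrow> sat n sys x (W s)"
      "\<And>s. s \<in> sys \<Longrightarrow> snd s x + k * of_rat (\<Sum>j<n. \<bar>fst s j\<bar>) \<le> lin n (fst s) (W s)"
    by (metis bchoice)
  define v where "v j = (\<Sum>s\<in>sys. W s j) / k" for j
  have "F x \<le> lin n a (\<lambda>j. of_int \<lfloor>v j\<rfloor>)" if s: "(a, F) \<in> sys" for a F
  proof -
    let ?d = "of_rat (\<Sum>j<n. \<bar>a j\<bar>) :: real"
    have Wa: "F x \<le> lin n a (W t)" if "t \<in> sys" for t
      using W(1)[OF that] s unfolding sat_def by blast
    have "k * F x + k * ?d = (F x + k * ?d) + (\<Sum>t\<in>sys - {(a, F)}. F x)"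
      using assms(1) s k by (simp add: k_def algebra_simps card_Diff_singleton of_nat_diff card_gt_0_iff Suc_leI)
    also have "\<dots> \<le> lin n a (W (a, F)) + (\<Sum>t\<in>sys - {(a, F)}. lin n a (W t))"
      using W(2)[OF s] Wa by (intro add_mono sum_mono) auto
    also have "\<dots> = (\<Sum>t\<in>sys. lin n a (W t))"
      using assms(1) s by (simp add: sum.remove)
    also have "\<dots> = k * lin n a v"
      unfolding v_def lin_average using k by simp
    finally have "k * (F x + ?d) \<le> k * lin n a v" by (simp add: algebra_simps)
    then have 1: "F x + ?d \<le> lin n a v" using k by simp
    have "\<bar>lin n a (\<lambda>j. v j - of_int \<lfloor>v j\<rfloor>)\<bar> \<le> ?d"
      by (rule abs_lin_le) (simp add: abs_le_iff, linarith)
    with 1 show ?thesis unfolding lin_diff by linarith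
  qed
  then show ?thesis unfolding int_sat_def sat_def by (intro exI[of _ "\<lambda>j. of_int \<lfloor>v j\<rfloor>"]) auto
qed

text \<open>
  The feasibility problem has a finite certificate set inside \<open>D\<close>: each cut of \<open>R\<close> has the form
  \<open>F x \<le> 0\<close>, and any parameter without an integer solution violates one of them. Whether the cuts
  of \<open>D\<close> are valid is left open here; that is a property of the family chosen in an application.
\<close>
definition refutable :: "nat \<Rightarrow> 'x cut set \<Rightarrow> 'x cut set \<Rightarrow> bool" where
  "refutable n D sys \<longleftrightarrow> (\<exists>R. finite R \<and> R \<subseteq> D \<and> (\<forall>(a, F)\<in>R. \<forall>j<n. a j = 0) \<and>
     (\<forall>x. (\<forall>(a, F)\<in>R. F x \<le> 0) \<longrightarrow> int_sat n sys x))"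

definition closed_family :: "nat \<Rightarrow> 'x cut set \<Rightarrow> bool" where
  "closed_family n D \<longleftrightarrow> comb_closed D \<and> ceil_closed n D"

definition system_in :: "nat \<Rightarrow> 'x cut set \<Rightarrow> 'x cut set \<Rightarrow> bool" where
  "system_in n D sys \<longleftrightarrow> finite sys \<and> sys \<subseteq> D \<and> (\<forall>(a, F)\<in>sys. integral n a)"

section \<open>Raising the lower bound of the last variable\<close>

text \<open>
  On the hyperplane \<open>w\<^sub>n = L x\<close> a cut \<open>(b, G)\<close> of \<open>D\<close> becomes a cut in the remaining variables
  with right-hand side \<open>G x - b\<^sub>n L x\<close>. Subtracting a Chvatal function is not a Chvatal operation;
  hence the family records the functions \<open>H\<close> for which adding a multiple of \<open>L\<close> leads back to \<open>D\<close>.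
  The vector \<open>b\<close> is only required to agree with \<open>a\<close> below \<open>n\<close>, since coefficients beyond the dimension
  are arbitrary.
\<close>
definition face_family :: "nat \<Rightarrow> ('x \<Rightarrow> real) \<Rightarrow> 'x cut set \<Rightarrow> 'x cut set" where
  "face_family n L D =
    {(a, H). \<exists>b. (\<forall>j<n. b j = a j) \<and> (b, (\<lambda>x. H x + of_rat (b n) * L x)) \<in> D}"

definition last_unit :: "nat \<Rightarrow> (nat \<Rightarrow> rat) \<Rightarrow> bool" where
  "last_unit n u \<longleftrightarrow> (\<forall>j<n. u j = 0) \<and> u n = 1"

text \<open>
  Closure under rounding is the point. If \<open>a\<close> is integral, its lift \<open>b\<close> may still have a fractional
  last coefficient. Adding a fractional multiple of \<open>w\<^sub>n \<ge> L x\<close>, which is an equation on the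
  hyperplane, makes that coefficient integral without changing \<open>H\<close>. Then rounding is possible in
  \<open>D\<close>, and the integer \<open>b\<^sub>n L x\<close> passes through the ceiling.
\<close>
lemma face_family_closed:
  assumes D: "closed_family (Suc n) D" and u: "(u, L) \<in> D" "last_unit n u" and L: "\<And>x. L x \<in> \<int>"
  shows "closed_family n (face_family n L D)"
  unfolding closed_family_def
proof
  have comb: "comb_closed D" and ceil: "ceil_closed (Suc n) D" using D by (auto simp: closed_family_def)
  show "comb_closed (face_family n L D)"
    unfolding comb_closed_def
  proof (intro allI impI)
    fix a F b G and \<alpha> \<beta> :: rat
    assume "(a, F) \<in> face_family n L D" "(b, G) \<in> face_family n L D" and nn: "\<alpha> \<ge> 0" "\<beta> \<ge> 0"
    then obtain a' b' where a': "\<forall>j<n. a' j = a j" "(a', \<lambda>x. F x + of_rat (a' n) * L x) \<in> D"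
        and b': "\<forall>j<n. b' j = b j" "(b', \<lambda>x. G x + of_rat (b' n) * L x) \<in> D"
      by (auto simp: face_family_def)
    let ?c = "\<lambda>j. \<alpha> * a' j + \<beta> * b' j"
    have "(?c, \<lambda>x. (of_rat \<alpha> * F x + of_rat \<beta> * G x) + of_rat (?c n) * L x) \<in> D"
      by (rule comb_closedD[OF comb a'(2) b'(2) nn]) (auto simp: of_rat_add of_rat_mult algebra_simps)
    then show "(\<lambda>j. \<alpha> * a j + \<beta> * b j, \<lambda>x. of_rat \<alpha> * F x + of_rat \<beta> * G x) \<in> face_family n L D"
      unfolding face_family_def using a'(1) b'(1) by (auto intro!: exI[of _ ?c])
  qed
  show "ceil_closed n (face_family n L D)"
    unfolding ceil_closed_def
  proof (intro allI impI)
    fix a H assume "(a, H) \<in> face_family n L D" and int: "integral n a"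
    then obtain b where b: "\<forall>j<n. b j = a j" "(b, \<lambda>x. H x + of_rat (b n) * L x) \<in> D"
      by (auto simp: face_family_def)
    define c where "c j = b j + (of_int \<lceil>b n\<rceil> - b n) * u j" for j
    have cn: "c n = of_int \<lceil>b n\<rceil>" and cj: "\<forall>j<n. c j = a j"
      using u(2) b(1) by (auto simp: c_def last_unit_def)
    have cD: "(c, \<lambda>x. H x + of_rat (c n) * L x) \<in> D"
    proof (rule comb_closedD[OF comb b(2) u(1)])
      show "c j = 1 * b j + (of_int \<lceil>b n\<rceil> - b n) * u j" for j by (simp add: c_def)
      show "H x + of_rat (c n) * L x = of_rat 1 * (H x + of_rat (b n) * L x) + of_rat (of_int \<lceil>b n\<rceil> - b n) * L x" for x
        by (simp add: cn of_rat_diff algebra_simps)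
    qed auto
    have c_int: "integral (Suc n) c"
      using int cj cn by (auto simp: integral_def less_Suc_eq)
    have "of_int \<lceil>H x\<rceil> + of_rat (c n) * L x = of_int \<lceil>H x + of_rat (c n) * L x\<rceil>" for x
    proof -
      obtain z where "L x = of_int z" using L by (auto elim: Ints_cases)
      then have "of_rat (c n) * L x = of_int (\<lceil>b n\<rceil> * z)" by (simp add: cn)
      then show ?thesis by (metis ceiling_add_of_int of_int_add)
    qed
    then have "(c, \<lambda>x. of_int \<lceil>H x\<rceil> + of_rat (c n) * L x) \<in> D"
      by (rule ceil_closedD[OF ceil cD c_int])
    then show "(a, \<lambda>x. of_int \<lceil>H x\<rceil>) \<in> face_family n L D"
      unfolding face_family_def using cj by blast
  qed
qed

text \<open>
  The induction hypothesis, applied on the hyperplane \<open>w\<^sub>n = L x\<close>, yields \<open>H x \<le> 0\<close> as certificates.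
  Each of them lifts to a cut \<open>m w\<^sub>n \<ge> H x + m L x\<close>, which for \<open>H x > 0\<close> and \<open>m > 0\<close> improves the
  bound \<open>L x\<close>. Conversely, if no bound is improved, then there is an integer solution with
  \<open>w\<^sub>n = L x\<close>.
\<close>
lemma raise_bound:
  fixes D :: "'x cut set"
  assumes IH: "\<forall>(D :: 'x cut set) sys. closed_family n D \<longrightarrow> system_in n D sys \<longrightarrow> refutable n D sys"
    and D: "closed_family (Suc n) D" and sys: "system_in (Suc n) D sys"
    and u: "(u, L) \<in> D" "last_unit n u" and L: "\<And>x. L x \<in> \<int>"
  shows "\<exists>T. finite T \<and> T \<subseteq> D \<and> (\<forall>s\<in>T. last_unit n (fst s) \<and> (\<forall>x. snd s x \<in> \<int>)) \<and>
    (\<forall>x. (\<forall>s\<in>T. snd s x \<le> L x) \<longrightarrow> int_sat (Suc n) sys x)"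
proof -
  have comb: "comb_closed D" and ceil: "ceil_closed (Suc n) D" using D by (auto simp: closed_family_def)
  let ?E = "face_family n L D"
  define sys' :: "'x cut set" where "sys' = (\<lambda>(a, F). (a, \<lambda>x. F x - of_rat (a n) * L x)) ` sys"
  have "system_in n ?E sys'"
    using sys unfolding system_in_def sys'_def face_family_def integral_def
    by (fastforce simp: case_prod_beta)
  from IH[rule_format, OF face_family_closed[OF D u L] this] obtain R
    where R: "finite R" "R \<subseteq> ?E" "\<forall>(a, F)\<in>R. \<forall>j<n. a j = 0"
      "\<And>x. \<forall>(a, F)\<in>R. F x \<le> 0 \<Longrightarrow> int_sat n sys' x"
    unfolding refutable_def by blast
  have "\<forall>s\<in>R. \<exists>t\<in>D. last_unit n (fst t) \<and> (\<forall>x. snd t x \<in> \<int>) \<and> (\<forall>x. snd s x > 0 \<longrightarrow> snd t x > L x)"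
  proof
    fix s assume s: "s \<in> R"
    obtain a H where aH: "s = (a, H)" by (cases s)
    have "(a, H) \<in> ?E" and a: "\<forall>j<n. a j = 0" using s R(2,3) unfolding aH by blast+
    then obtain b where "\<forall>j<n. b j = a j" and bD: "(b, \<lambda>x. H x + of_rat (b n) * L x) \<in> D"
      by (auto simp: face_family_def)
    with a have b: "\<forall>j<n. b j = 0" "(b, \<lambda>x. H x + of_rat (b n) * L x) \<in> D" by auto
    \<comment> \<open>Adding a large enough multiple of \<open>w\<^sub>n \<ge> L x\<close> makes the last coefficient positive.\<close>
    define m where "m = \<bar>b n\<bar> + 1"
    have m: "m > 0" "m \<ge> b n" by (auto simp: m_def)
    define c where "c j = (1/m) * b j + ((m - b n)/m) * u j" for j
    have c: "last_unit n c" using b(1) u(2) m by (auto simp: c_def last_unit_def field_simps)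
    have "(c, \<lambda>x. of_rat (1/m) * H x + L x) \<in> D"
    proof (rule comb_closedD[OF comb b(2) u(1)])
      fix x
      have "of_rat m \<noteq> (0::real)" using m by simp
      then show "of_rat (1/m) * H x + L x = of_rat (1/m) * (H x + of_rat (b n) * L x) + of_rat ((m - b n)/m) * L x"
        using m by (simp add: of_rat_divide of_rat_diff field_simps)
    qed (use m in \<open>auto simp: c_def\<close>)
    then have "(c, \<lambda>x. of_int \<lceil>of_rat (1/m) * H x + L x\<rceil>) \<in> D"
      by (rule ceil_closedD[OF ceil]) (use c in \<open>auto simp: integral_def last_unit_def less_Suc_eq\<close>)
    moreover have "L x < of_int \<lceil>of_rat (1/m) * H x + L x\<rceil>" if "H x > 0" for x
    proof -
      have "of_rat (1/m) * H x > 0" using that m by simp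
      then show ?thesis by linarith
    qed
    ultimately show "\<exists>t\<in>D. last_unit n (fst t) \<and> (\<forall>x. snd t x \<in> \<int>) \<and> (\<forall>x. snd s x > 0 \<longrightarrow> snd t x > L x)"
      using c aH by force
  qed
  then obtain f where f: "\<And>s. s \<in> R \<Longrightarrow> f s \<in> D \<and> last_unit n (fst (f s)) \<and> (\<forall>x. snd (f s) x \<in> \<int>) \<and>
      (\<forall>x. snd s x > 0 \<longrightarrow> snd (f s) x > L x)"
    by (metis bchoice)
  show ?thesis
  proof (intro exI[of _ "f ` R"] conjI allI impI)
    show "\<forall>t\<in>f ` R. last_unit n (fst t) \<and> (\<forall>x. snd t x \<in> \<int>)" using f by blast
    fix x assume le: "\<forall>t\<in>f ` R. snd t x \<le> L x"
    have "\<forall>(a, F)\<in>R. F x \<le> 0"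
    proof clarify
      fix a F assume aF: "(a, F) \<in> R"
      show "F x \<le> 0"
      proof (rule ccontr)
        assume "\<not> F x \<le> 0"
        then have "L x < snd (f (a, F)) x" using f[OF aF] by auto
        moreover have "snd (f (a, F)) x \<le> L x" using le aF by blast
        ultimately show False by simp
      qed
    qed
    from R(4)[OF this] obtain w where w: "\<forall>j. w j \<in> \<int>" "sat n sys' x w" by (auto simp: int_sat_def)
    have "sat (Suc n) sys x (w(n := L x))"
      unfolding sat_def
    proof clarify
      fix a F assume "(a, F) \<in> sys"
      then have "(a, \<lambda>x. F x - of_rat (a n) * L x) \<in> sys'" unfolding sys'_def by force
      from satD[OF w(2) this] have "F x - of_rat (a n) * L x \<le> lin n a w" .
      moreover have "lin n a (w(n := L x)) = lin n a w" by (rule lin_cong) auto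
      ultimately show "F x \<le> lin (Suc n) a (w(n := L x))" by (simp add: lin_Suc)
    qed
    then show "int_sat (Suc n) sys x"
      unfolding int_sat_def using w(1) L by (intro exI[of _ "w(n := L x)"]) auto
  qed (use R(1) f in auto)
qed

text \<open>
  The new bounds of one step have no maximum inside \<open>D\<close>, so each of them is treated as the start of
  its own next step: the bounds form a finitely branching tree of depth \<open>K\<close>. For a parameter without
  an integer solution, some branch gains at least \<open>1\<close> at every step, as all bounds are integral.
\<close>
lemma raise_bound_iterated:
  fixes D :: "'x cut set"
  assumes IH: "\<forall>(D :: 'x cut set) sys. closed_family n D \<longrightarrow> system_in n D sys \<longrightarrow> refutable n D sys"
    and D: "closed_family (Suc n) D" and sys: "system_in (Suc n) D sys"
    and u: "(u, L) \<in> D" "last_unit n u" and L: "\<And>x. L x \<in> \<int>"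
  shows "\<exists>T. finite T \<and> T \<subseteq> D \<and> (\<forall>s\<in>T. last_unit n (fst s) \<and> (\<forall>x. snd s x \<in> \<int>)) \<and>
    (\<forall>x. (\<forall>s\<in>T. snd s x < L x + real K) \<longrightarrow> int_sat (Suc n) sys x)"
proof (induction K)
  case 0
  have "\<forall>s\<in>{(u, L)}. last_unit n (fst s) \<and> (\<forall>x. snd s x \<in> \<int>)" using u L by simp
  then show ?case using u(1) by (intro exI[of _ "{(u, L)}"]) simp
next
  case (Suc K)
  then obtain T where fin: "finite T" and TD: "T \<subseteq> D"
    and unit: "\<forall>s\<in>T. last_unit n (fst s) \<and> (\<forall>x. snd s x \<in> \<int>)"
    and T: "\<forall>x. (\<forall>s\<in>T. snd s x < L x + real K) \<longrightarrow> int_sat (Suc n) sys x" by blast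
  have "\<forall>s\<in>T. \<exists>T'. finite T' \<and> T' \<subseteq> D \<and> (\<forall>s\<in>T'. last_unit n (fst s) \<and> (\<forall>x. snd s x \<in> \<int>)) \<and>
      (\<forall>x. (\<forall>t\<in>T'. snd t x \<le> snd s x) \<longrightarrow> int_sat (Suc n) sys x)"
  proof
    fix s assume s: "s \<in> T"
    show "\<exists>T'. finite T' \<and> T' \<subseteq> D \<and> (\<forall>s\<in>T'. last_unit n (fst s) \<and> (\<forall>x. snd s x \<in> \<int>)) \<and>
      (\<forall>x. (\<forall>t\<in>T'. snd t x \<le> snd s x) \<longrightarrow> int_sat (Suc n) sys x)"
    proof (rule raise_bound[OF IH D sys])
      show "(fst s, snd s) \<in> D" using s TD by auto
      show "last_unit n (fst s)" "snd s x \<in> \<int>" for x using unit s by auto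
    qed
  qed
  from bchoice[OF this] obtain f where "\<forall>s\<in>T. finite (f s) \<and> f s \<subseteq> D \<and>
      (\<forall>t\<in>f s. last_unit n (fst t) \<and> (\<forall>x. snd t x \<in> \<int>)) \<and>
      (\<forall>x. (\<forall>t\<in>f s. snd t x \<le> snd s x) \<longrightarrow> int_sat (Suc n) sys x)" ..
  then have f: "\<forall>s\<in>T. finite (f s)" "\<forall>s\<in>T. f s \<subseteq> D"
      "\<forall>s\<in>T. \<forall>t\<in>f s. last_unit n (fst t) \<and> (\<forall>x. snd t x \<in> \<int>)"
      "\<forall>s\<in>T. \<forall>x. (\<forall>t\<in>f s. snd t x \<le> snd s x) \<longrightarrow> int_sat (Suc n) sys x"
    by blast+
  show ?case
  proof (intro exI[of _ "\<Union> (f ` T)"] conjI allI impI)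
    show "finite (\<Union> (f ` T))" using fin f(1) by blast
    show "\<Union> (f ` T) \<subseteq> D" using f(2) by blast
    show "\<forall>s\<in>\<Union> (f ` T). last_unit n (fst s) \<and> (\<forall>x. snd s x \<in> \<int>)" using f(3) by blast
    fix x assume less: "\<forall>s\<in>\<Union> (f ` T). snd s x < L x + real (Suc K)"
    show "int_sat (Suc n) sys x"
    proof (rule ccontr)
      assume no: "\<not> int_sat (Suc n) sys x"
      then have "\<not> (\<forall>s\<in>T. snd s x < L x + real K)" using T by blast
      then obtain s where s: "s \<in> T" "L x + real K \<le> snd s x" by (auto simp: not_less)
      have "\<not> (\<forall>t\<in>f s. snd t x \<le> snd s x)" using f(4) s(1) no by blast
      then obtain t where t: "t \<in> f s" "snd s x < snd t x" by (auto simp: not_le)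
      have "snd t x \<in> \<int>" "snd s x \<in> \<int>" using f(3) unit t(1) s(1) by blast+
      with t(2) have "snd s x + 1 \<le> snd t x" by (auto elim!: Ints_cases)
      moreover have "snd t x < L x + real (Suc K)" using less s(1) t(1) by blast
      ultimately show False using s(2) by simp
    qed
  qed
qed

section \<open>Unimodular changes of coordinates\<close>

text \<open>
  \<open>T\<close> acts on coefficient vectors and its adjoint \<open>S\<close> on points. Instead of a matrix of determinant
  \<open>\<plusminus>1\<close>, the definition lists what the transport of a system along \<open>T\<close> uses; invertibility over the
  integers enters through the equivalence in the second clause together with injectivity.
\<close>
definition unimodular :: "nat \<Rightarrow> ((nat \<Rightarrow> rat) \<Rightarrow> (nat \<Rightarrow> rat)) \<Rightarrow> ((nat \<Rightarrow> real) \<Rightarrow> (nat \<Rightarrow> real)) \<Rightarrow> bool" where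
  "unimodular n T S \<longleftrightarrow>
     (\<forall>\<alpha> \<beta> a b. T (\<lambda>j. \<alpha> * a j + \<beta> * b j) = (\<lambda>j. \<alpha> * T a j + \<beta> * T b j)) \<and>
     (\<forall>a. integral n (T a) \<longleftrightarrow> integral n a) \<and>
     (\<forall>a b. (\<forall>j<n. T a j = T b j) \<longrightarrow> (\<forall>j<n. a j = b j)) \<and>
     (\<forall>a w. lin n (T a) w = lin n a (S w)) \<and>
     (\<forall>w. (\<forall>j. w j \<in> \<int>) \<longrightarrow> (\<forall>j. S w j \<in> \<int>))"

lemma unimodularI:
  assumes "\<And>\<alpha> \<beta> a b j. T (\<lambda>j. \<alpha> * a j + \<beta> * b j) j = \<alpha> * T a j + \<beta> * T b j"
    and "\<And>a. integral n (T a) \<longleftrightarrow> integral n a"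
    and "\<And>a b. \<forall>j<n. T a j = T b j \<Longrightarrow> \<forall>j<n. a j = b j"
    and "\<And>a w. lin n (T a) w = lin n a (S w)"
    and "\<And>w j. \<forall>j. w j \<in> \<int> \<Longrightarrow> S w j \<in> \<int>"
  shows "unimodular n T S"
  using assms unfolding unimodular_def by blast

lemma
  assumes "unimodular n T S"
  shows unimodular_comb: "T (\<lambda>j. \<alpha> * a j + \<beta> * b j) = (\<lambda>j. \<alpha> * T a j + \<beta> * T b j)"
    and unimodular_integral: "integral n (T a) \<longleftrightarrow> integral n a"
    and unimodular_inj: "\<forall>j<n. T a j = T b j \<Longrightarrow> \<forall>j<n. a j = b j"
    and unimodular_lin: "lin n (T a) w = lin n a (S w)"
    and unimodular_Ints: "\<forall>j. w j \<in> \<int> \<Longrightarrow> S w j \<in> \<int>"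
  using assms unfolding unimodular_def by blast+

lemma unimodular_comp:
  assumes TS: "unimodular n T S" and TS': "unimodular n T' S'"
  shows "unimodular n (T' \<circ> T) (S \<circ> S')"
proof (rule unimodularI)
  show "(T' \<circ> T) (\<lambda>j. \<alpha> * a j + \<beta> * b j) j = \<alpha> * (T' \<circ> T) a j + \<beta> * (T' \<circ> T) b j" for \<alpha> \<beta> a b j
    unfolding o_apply unimodular_comb[OF TS] unimodular_comb[OF TS'] ..
  show "integral n ((T' \<circ> T) a) \<longleftrightarrow> integral n a" for a
    unfolding o_apply unimodular_integral[OF TS'] unimodular_integral[OF TS] ..
  show "\<forall>j<n. a j = b j" if "\<forall>j<n. (T' \<circ> T) a j = (T' \<circ> T) b j" for a b
    using that unfolding o_apply by (rule unimodular_inj[OF TS unimodular_inj[OF TS']])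
  show "lin n ((T' \<circ> T) a) w = lin n a ((S \<circ> S') w)" for a w
    unfolding o_apply unimodular_lin[OF TS'] unimodular_lin[OF TS] ..
  show "(S \<circ> S') w j \<in> \<int>" if "\<forall>j. w j \<in> \<int>" for w j
    using unimodular_Ints[OF TS' that] unimodular_Ints[OF TS] by simp
qed

lemma unimodular_id: "unimodular n id id"
  by (simp add: unimodular_def)

lemma unimodular_negate: "unimodular n (\<lambda>a. a(i := - a i)) (\<lambda>w. w(i := - w i))"
proof (rule unimodularI)
  show "lin n (a(i := - a i)) w = lin n a (w(i := - w i))" for a w
    unfolding lin_def by (rule sum.cong) (auto simp: of_rat_minus)
  show "integral n (a(i := - a i)) \<longleftrightarrow> integral n a" for a
    unfolding integral_def by (auto simp: minus_in_Ints_iff)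
  show "\<forall>j<n. a j = b j" if "\<forall>j<n. (a(i := - a i)) j = (b(i := - b i)) j" for a b :: "nat \<Rightarrow> rat"
    using that by (metis fun_upd_apply neg_equal_iff_equal)
qed simp_all

lemma unimodular_add:
  assumes ij: "i < n" "j < n" "i \<noteq> j"
  shows "unimodular n (\<lambda>a. a(i := a i + of_int t * a j)) (\<lambda>w. w(j := w j + of_int t * w i))"
proof (rule unimodularI)
  show "lin n (a(i := a i + of_int t * a j)) w = lin n a (w(j := w j + of_int t * w i))" for a w
  proof -
    have "lin n (a(i := a i + of_int t * a j)) w = lin n a w + of_rat (of_int t * a j) * w i"
      unfolding lin_def using ij
      by (simp add: sum.remove[of "{..<n}" i] of_rat_add algebra_simps)
    also have "\<dots> = lin n a (w(j := w j + of_int t * w i))"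
      unfolding lin_def using ij
      by (simp add: sum.remove[of "{..<n}" j] of_rat_mult algebra_simps)
    finally show ?thesis .
  qed
  show "integral n (a(i := a i + of_int t * a j)) \<longleftrightarrow> integral n a" for a
  proof
    assume int: "integral n (a(i := a i + of_int t * a j))"
    have "a i + of_int t * a j \<in> \<int>" using int ij(1) unfolding integral_def by (metis fun_upd_same)
    moreover have "a j \<in> \<int>" using int ij(2,3) unfolding integral_def by (metis fun_upd_other)
    ultimately have "(a i + of_int t * a j) - of_int t * a j \<in> \<int>" by (intro Ints_diff Ints_mult) auto
    then have "a i \<in> \<int>" by simp
    then show "integral n a" using int unfolding integral_def by (metis fun_upd_other)
  next
    assume "integral n a"
    then show "integral n (a(i := a i + of_int t * a j))" using ij by (simp add: integral_def)
  qed
  show "\<forall>l<n. a l = b l"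
    if eq: "\<forall>l<n. (a(i := a i + of_int t * a j)) l = (b(i := b i + of_int t * b j)) l" for a b :: "nat \<Rightarrow> rat"
  proof -
    have "a j = b j" using eq[rule_format, of j] ij by simp
    then have "a i = b i" using eq[rule_format, of i] ij by simp
    then show ?thesis using eq by (metis fun_upd_other)
  qed
qed (auto simp: algebra_simps)

text \<open>
  This is the Euclidean algorithm on the entries of \<open>c\<close>: subtracting a nonzero entry from one that is
  at least as large in absolute value decreases the sum of the absolute values. The last entry
  must not become \<open>0\<close>, so it is reduced only by strictly smaller entries.
\<close>
lemma euclid_nonzero_last:
  assumes "integral (Suc n) c" "c n \<noteq> 0" "(\<Sum>j<Suc n. \<bar>c j\<bar>) \<le> of_nat m"
  shows "\<exists>T S. unimodular (Suc n) T S \<and> (\<forall>j<n. T c j = 0) \<and> T c n > 0"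
  using assms
proof (induction m arbitrary: c)
  case 0
  have "0 \<le> (\<Sum>j<n. \<bar>c j\<bar>)" by (rule sum_nonneg) simp
  moreover have "0 < \<bar>c n\<bar>" using 0(2) by simp
  moreover have "(\<Sum>j<n. \<bar>c j\<bar>) + \<bar>c n\<bar> \<le> 0" using 0(3) by simp
  ultimately show ?case by linarith
next
  case (Suc m)
  have one: "\<bar>c j\<bar> \<ge> 1" if "j < Suc n" "c j \<noteq> 0" for j
    using Suc.prems(1) that by (intro Ints_nonzero_abs_ge1) (auto simp: integral_def)
  show ?case
  proof (cases "\<forall>j<n. c j = 0")
    case True
    show ?thesis
    proof (cases "c n > 0")
      case neg: False
      then have "- c n > 0" using Suc.prems(2) by simp
      show ?thesis by (intro exI conjI, rule unimodular_negate[of _ n]) (use True \<open>- c n > 0\<close> in simp_all)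
    next
      case pos: True
      show ?thesis by (intro exI conjI, rule unimodular_id) (simp_all add: True pos)
    qed
  next
    case False
    then obtain i0 where i0: "i0 < n" "c i0 \<noteq> 0" by blast
    obtain i j where ij: "i < Suc n" "j < Suc n" "i \<noteq> j" "c i \<noteq> 0" "c j \<noteq> 0" "\<bar>c j\<bar> \<le> \<bar>c i\<bar>"
        "i = n \<longrightarrow> \<bar>c j\<bar> < \<bar>c i\<bar>"
    proof (cases "\<bar>c n\<bar> \<le> \<bar>c i0\<bar>")
      case True
      show ?thesis by (rule that[of i0 n]) (use True i0 Suc.prems(2) in simp_all)
    next
      case False
      show ?thesis by (rule that[of n i0]) (use False i0 Suc.prems(2) in simp_all)
    qed
    define t :: int where "t = (if c i * c j > 0 then -1 else 1)"
    let ?T = "\<lambda>a::nat \<Rightarrow> rat. a(i := a i + of_int t * a j)"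
    have abs: "\<bar>c i + of_int t * c j\<bar> = \<bar>c i\<bar> - \<bar>c j\<bar>"
      using ij(4-6) by (auto simp: t_def zero_less_mult_iff abs_if split: if_splits)
    note U = unimodular_add[OF ij(1-3), of t]
    have "(\<Sum>l<Suc n. \<bar>?T c l\<bar>) = (\<Sum>l<Suc n. \<bar>c l\<bar>) - \<bar>c j\<bar>"
      using ij(1) abs by (simp add: sum.remove[of "{..<Suc n}" i] del: sum.lessThan_Suc)
    also have "\<dots> \<le> of_nat m" using Suc.prems(3) one[OF ij(2,5)] by simp
    finally have le: "(\<Sum>l<Suc n. \<bar>?T c l\<bar>) \<le> of_nat m" .
    have "?T c n \<noteq> 0" using abs ij(7) Suc.prems(2) by auto
    moreover have "integral (Suc n) (?T c)" using unimodular_integral[OF U] Suc.prems(1) by simp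
    ultimately obtain T S where TS: "unimodular (Suc n) T S" "\<forall>j<n. T (?T c) j = 0" "T (?T c) n > 0"
      using Suc.IH[of "?T c"] le by blast
    show ?thesis by (intro exI conjI, rule unimodular_comp[OF U TS(1)]) (use TS(2,3) in \<open>simp_all only: o_apply\<close>)
  qed
qed

lemma unimodular_to_last:
  assumes "integral (Suc n) c" "j < Suc n" "c j \<noteq> 0"
  shows "\<exists>T S. unimodular (Suc n) T S \<and> (\<forall>j<n. T c j = 0) \<and> T c n > 0"
proof -
  have *: "\<exists>T S. unimodular (Suc n) T S \<and> (\<forall>j<n. T c j = 0) \<and> T c n > 0"
    if "integral (Suc n) c" "c n \<noteq> 0" for c
  proof -
    obtain m where "(\<Sum>j<Suc n. \<bar>c j\<bar>) \<le> of_nat m" using real_arch_simple by blast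
    then show ?thesis by (rule euclid_nonzero_last[OF that])
  qed
  show ?thesis
  proof (cases "c n = 0")
    case True
    then have "j \<noteq> n" using assms by auto
    note U = unimodular_add[of n "Suc n" j 1, OF _ assms(2) this[symmetric], simplified]
    let ?T = "\<lambda>a::nat \<Rightarrow> rat. a(n := a n + a j)"
    have "integral (Suc n) (?T c)" using unimodular_integral[OF U] assms(1) by simp
    then obtain T S where TS: "unimodular (Suc n) T S" "\<forall>j<n. T (?T c) j = 0" "T (?T c) n > 0"
      using *[of "?T c"] True assms(3) by auto
    show ?thesis by (intro exI conjI, rule unimodular_comp[OF U TS(1)]) (use TS(2,3) in \<open>simp_all only: o_apply\<close>)
  next
    case False
    then show ?thesis by (rule *[OF assms(1)])
  qed
qed

section \<open>Eliminating integer variables\<close>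

text \<open>
  A row \<open>g w\<^sub>n \<ge> G x\<close> with \<open>g \<ge> 1\<close> is divided by \<open>g\<close> and rounded. Raising the resulting bound on
  \<open>w\<^sub>n\<close> by \<open>K\<close> and multiplying by \<open>g\<close> again raises the original row by at least \<open>g K \<ge> K\<close>.
\<close>
lemma raise_row_last:
  fixes D :: "'x cut set"
  assumes IH: "\<forall>(D :: 'x cut set) sys. closed_family n D \<longrightarrow> system_in n D sys \<longrightarrow> refutable n D sys"
    and D: "closed_family (Suc n) D" and sys: "system_in (Suc n) D sys"
    and c: "(c, G) \<in> D" "integral (Suc n) c" "\<forall>j<n. c j = 0" "c n > 0"
  shows "\<exists>T. finite T \<and> T \<subseteq> D \<and> (\<forall>s\<in>T. \<forall>j<Suc n. fst s j = c j) \<and>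
    (\<forall>x. (\<forall>s\<in>T. snd s x < G x + real K) \<longrightarrow> int_sat (Suc n) sys x)"
proof -
  have comb: "comb_closed D" and ceil: "ceil_closed (Suc n) D" using D by (auto simp: closed_family_def)
  define g where "g = c n"
  have g: "g \<ge> 1" using c(2,4) Ints_nonzero_abs_ge1[of g] by (auto simp: g_def integral_def)
  then have g': "(of_rat g :: real) \<ge> 1" by simp
  define u where "u j = (1/g) * c j" for j
  define L :: "'x \<Rightarrow> real" where "L x = of_int \<lceil>of_rat (1/g) * G x\<rceil>" for x
  have u: "last_unit n u" using c(3) g by (auto simp: u_def last_unit_def g_def)
  have "(u, \<lambda>x. of_rat (1/g) * G x) \<in> D"
    by (rule scale_closedD[OF comb c(1), of "1/g"]) (use g in \<open>auto simp: u_def\<close>)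
  then have uL: "(u, L) \<in> D"
    by (rule ceil_closedD[OF ceil]) (use u in \<open>auto simp: L_def integral_def last_unit_def less_Suc_eq\<close>)
  have L_Ints: "L x \<in> \<int>" for x by (simp add: L_def)
  obtain T where fin: "finite T" and TD: "T \<subseteq> D"
    and unit: "\<forall>s\<in>T. last_unit n (fst s) \<and> (\<forall>x. snd s x \<in> \<int>)"
    and T: "\<forall>x. (\<forall>s\<in>T. snd s x < L x + real K) \<longrightarrow> int_sat (Suc n) sys x"
    using raise_bound_iterated[OF IH D sys uL u L_Ints, of K] by (elim exE conjE)
  let ?f = "\<lambda>s::'x cut. ((\<lambda>j. g * fst s j), (\<lambda>x. of_rat g * snd s x))"
  show ?thesis
  proof (intro exI[of _ "?f ` T"] conjI allI impI)
    show "?f ` T \<subseteq> D"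
    proof (rule image_subsetI)
      fix s assume "s \<in> T"
      then have "(fst s, snd s) \<in> D" using TD by auto
      then show "?f s \<in> D" by (rule scale_closedD[OF comb, of _ _ g]) (use g in simp_all)
    qed
    have "fst (?f s) j = c j" if "s \<in> T" "j < Suc n" for s j
      using bspec[OF unit that(1)] that(2) c(3) by (cases "j = n") (simp_all add: last_unit_def g_def)
    then show "\<forall>s\<in>?f ` T. \<forall>j<Suc n. fst s j = c j" by blast
    fix x assume less: "\<forall>s\<in>?f ` T. snd s x < G x + real K"
    have "snd s x < L x + real K" if "s \<in> T" for s
    proof -
      have "of_rat g * snd s x < G x + real K" using bspec[OF less imageI[OF that]] by simp
      also have "\<dots> = of_rat g * (of_rat (1/g) * G x) + 1 * real K"
        using g' by (simp add: of_rat_divide)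
      also have "\<dots> \<le> of_rat g * L x + of_rat g * real K"
        using g' by (intro add_mono mult_left_mono mult_right_mono) (auto simp: L_def)
      also have "\<dots> = of_rat g * (L x + real K)" by (simp add: algebra_simps)
      finally show ?thesis using g' by simp
    qed
    then show "int_sat (Suc n) sys x" using T by blast
  qed (use fin in simp)
qed

text \<open>
  A unimodular change of coordinates turns an arbitrary nonzero row into a multiple of the last
  coordinate and transports closed families, systems and integer solutions.
\<close>
lemma raise_row:
  fixes D :: "'x cut set"
  assumes IH: "\<forall>(D :: 'x cut set) sys. closed_family n D \<longrightarrow> system_in n D sys \<longrightarrow> refutable n D sys"
    and D: "closed_family (Suc n) D" and sys: "system_in (Suc n) D sys"
    and c: "(c, G) \<in> D" "integral (Suc n) c" "\<exists>j<Suc n. c j \<noteq> 0"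
  shows "\<exists>R. finite R \<and> R \<subseteq> D \<and> (\<forall>s\<in>R. \<forall>j<Suc n. fst s j = c j) \<and>
    (\<forall>x. (\<forall>s\<in>R. snd s x < G x + real K) \<longrightarrow> int_sat (Suc n) sys x)"
proof -
  obtain T S where U: "unimodular (Suc n) T S" and Tc: "\<forall>j<n. T c j = 0" "T c n > 0"
    using unimodular_to_last c(2,3) by blast
  note T_comb = unimodular_comb[OF U] and T_int = unimodular_integral[OF U]
    and T_inj = unimodular_inj[OF U] and adj = unimodular_lin[OF U] and S_int = unimodular_Ints[OF U]
  let ?t = "map_prod T id :: 'x cut \<Rightarrow> 'x cut"
  have "comb_closed (?t ` D)"
    unfolding comb_closed_def
  proof (intro allI impI)
    fix a F b G and \<alpha> \<beta> :: rat
    assume "(a, F) \<in> ?t ` D" "(b, G) \<in> ?t ` D" and nn: "\<alpha> \<ge> 0" "\<beta> \<ge> 0"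
    then obtain a' b' where a': "a = T a'" "(a', F) \<in> D" and b': "b = T b'" "(b', G) \<in> D" by auto
    have "((\<lambda>j. \<alpha> * a' j + \<beta> * b' j), (\<lambda>x. of_rat \<alpha> * F x + of_rat \<beta> * G x)) \<in> D"
      using D a' b' nn unfolding closed_family_def comb_closed_def by blast
    then show "((\<lambda>j. \<alpha> * a j + \<beta> * b j), (\<lambda>x. of_rat \<alpha> * F x + of_rat \<beta> * G x)) \<in> ?t ` D"
      unfolding a' b' T_comb[symmetric] by (force simp: image_iff)
  qed
  moreover have "ceil_closed (Suc n) (?t ` D)"
    unfolding ceil_closed_def
  proof (intro allI impI)
    fix a F assume "(a, F) \<in> ?t ` D" and int: "integral (Suc n) a"
    then obtain a' where a': "a = T a'" "(a', F) \<in> D" by auto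
    have "(a', \<lambda>x. of_int \<lceil>F x\<rceil>) \<in> D"
      using D a' int T_int[of a'] unfolding closed_family_def ceil_closed_def by blast
    then show "(a, \<lambda>x. of_int \<lceil>F x\<rceil>) \<in> ?t ` D" unfolding a' by force
  qed
  ultimately have "closed_family (Suc n) (?t ` D)" by (simp add: closed_family_def)
  moreover have "system_in (Suc n) (?t ` D) (?t ` sys)"
    using sys T_int unfolding system_in_def by fastforce
  moreover have "(T c, G) \<in> ?t ` D" using c(1) by force
  moreover have "integral (Suc n) (T c)" using c(2) T_int by simp
  ultimately have "\<exists>R'. finite R' \<and> R' \<subseteq> ?t ` D \<and> (\<forall>s\<in>R'. \<forall>j<Suc n. fst s j = T c j) \<and>
      (\<forall>x. (\<forall>s\<in>R'. snd s x < G x + real K) \<longrightarrow> int_sat (Suc n) (?t ` sys) x)"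
    using Tc by (intro raise_row_last[OF IH])
  then obtain R' where fin': "finite R'" and sub': "R' \<subseteq> ?t ` D"
    and row': "\<forall>s\<in>R'. \<forall>j<Suc n. fst s j = T c j"
    and R': "\<forall>x. (\<forall>s\<in>R'. snd s x < G x + real K) \<longrightarrow> int_sat (Suc n) (?t ` sys) x"
    by (elim exE conjE)
  obtain R where R: "R \<subseteq> D" "finite R" "R' = ?t ` R"
    using finite_subset_image[OF fin' sub'] by blast
  show ?thesis
  proof (intro exI[of _ R] conjI allI impI)
    show "\<forall>s\<in>R. \<forall>j<Suc n. fst s j = c j"
    proof
      fix s assume "s \<in> R"
      then have "\<forall>j<Suc n. T (fst s) j = T c j" using row' unfolding R(3) by auto
      then show "\<forall>j<Suc n. fst s j = c j" by (rule T_inj)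
    qed
    fix x assume "\<forall>s\<in>R. snd s x < G x + real K"
    then have "\<forall>s\<in>R'. snd s x < G x + real K" unfolding R(3) by auto
    then have "int_sat (Suc n) (?t ` sys) x" using R' by blast
    then obtain w where w: "\<forall>j. w j \<in> \<int>" "sat (Suc n) (?t ` sys) x w"
      unfolding int_sat_def by blast
    have "sat (Suc n) sys x (S w)"
      unfolding sat_def
    proof clarify
      fix a F assume "(a, F) \<in> sys"
      then have "(T a, F) \<in> ?t ` sys" by force
      from satD[OF w(2) this] show "F x \<le> lin (Suc n) a (S w)" unfolding adj .
    qed
    then show "int_sat (Suc n) sys x" using S_int[OF w(1)] unfolding int_sat_def by blast
  qed (fact R)+
qed

text \<open>
  For each row, finitely many cuts raise its bound by at least the width that \<open>rounding\<close> tolerates;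
  \<open>B\<close> collects them. Real infeasibility of the system enlarged by any subset of \<open>B\<close> is refuted
  by Fourier-Motzkin elimination. An integer infeasible parameter that survives all these tests
  would have a thin row, and the enlargement by the raised cut of that row contradicts thinness.
\<close>
theorem integer_elimination:
  fixes D :: "'x cut set"
  assumes "closed_family n D" "system_in n D sys"
  shows "refutable n D sys"
  using assms
proof (induction n arbitrary: D sys)
  case 0
  show ?case unfolding refutable_def
    by (rule exI[of _ sys])
      (use 0 in \<open>auto simp: system_in_def int_sat_def sat_def lin_def intro!: exI[of _ "\<lambda>_. 0"]\<close>)
next
  case (Suc n)
  let ?n = "Suc n"
  have comb: "comb_closed D" using Suc.prems by (simp add: closed_family_def)
  have IH: "\<forall>(D :: 'x cut set) sys. closed_family n D \<longrightarrow> system_in n D sys \<longrightarrow> refutable n D sys"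
    using Suc.IH by blast
  have sys: "finite sys" "sys \<subseteq> D" "\<forall>(a, F)\<in>sys. integral ?n a"
    using Suc.prems by (auto simp: system_in_def)
  define width :: "'x cut \<Rightarrow> real" where "width s = real (card sys) * of_rat (\<Sum>j<?n. \<bar>fst s j\<bar>)" for s
  let ?sys = "{s\<in>sys. \<exists>j<?n. fst s j \<noteq> 0}"
  have "\<forall>s\<in>?sys. \<exists>R. finite R \<and> R \<subseteq> D \<and> (\<forall>t\<in>R. \<forall>j<?n. fst t j = fst s j) \<and>
    (\<forall>x. (\<forall>t\<in>R. snd t x < snd s x + real (nat \<lceil>width s\<rceil>)) \<longrightarrow> int_sat ?n sys x)"
  proof
    fix s assume s: "s \<in> ?sys"
    show "\<exists>R. finite R \<and> R \<subseteq> D \<and> (\<forall>t\<in>R. \<forall>j<?n. fst t j = fst s j) \<and>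
      (\<forall>x. (\<forall>t\<in>R. snd t x < snd s x + real (nat \<lceil>width s\<rceil>)) \<longrightarrow> int_sat ?n sys x)"
      by (rule raise_row[OF IH Suc.prems]) (use s sys in auto)
  qed
  from bchoice[OF this] obtain r where "\<forall>s\<in>?sys. finite (r s) \<and> r s \<subseteq> D \<and> (\<forall>t\<in>r s. \<forall>j<?n. fst t j = fst s j) \<and>
    (\<forall>x. (\<forall>t\<in>r s. snd t x < snd s x + real (nat \<lceil>width s\<rceil>)) \<longrightarrow> int_sat ?n sys x)" ..
  note r = bspec[OF this]
  define B where "B = \<Union> (r ` ?sys)"
  have "finite B"
    unfolding B_def
  proof (rule finite_UN_I)
    show "finite (r s)" if "s \<in> ?sys" for s using r[OF that] by (elim conjE)
  qed (use sys(1) in simp)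
  moreover have "B \<subseteq> D"
    unfolding B_def
  proof (rule UN_least)
    show "r s \<subseteq> D" if "s \<in> ?sys" for s using r[OF that] by (elim conjE)
  qed
  ultimately have B: "finite B" "B \<subseteq> D" by blast+
  have "\<forall>C\<in>Pow B. \<exists>R. finite R \<and> R \<subseteq> D \<and> (\<forall>(a, F)\<in>R. \<forall>j<?n. a j = 0) \<and>
           (\<forall>x. (\<forall>(a, F)\<in>R. F x \<le> 0) \<longrightarrow> (\<exists>w. sat ?n (sys \<union> C) x w))"
  proof (rule ballI, rule fourier_motzkin[OF comb])
    fix C assume C: "C \<in> Pow B"
    then show "finite (sys \<union> C)" using sys(1) B(1) by (auto intro: finite_subset)
    show "sys \<union> C \<subseteq> D" using C sys(2) B(2) by auto
  qed
  from bchoice[OF this] obtain q where "\<forall>C\<in>Pow B. finite (q C) \<and> q C \<subseteq> D \<and> (\<forall>(a, F)\<in>q C. \<forall>j<?n. a j = 0) \<and>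
           (\<forall>x. (\<forall>(a, F)\<in>q C. F x \<le> 0) \<longrightarrow> (\<exists>w. sat ?n (sys \<union> C) x w))" ..
  note q = bspec[OF this, OF PowI]
  define R where "R = \<Union> (q ` Pow B)"
  have "int_sat ?n sys x" if le: "\<forall>(a, F)\<in>R. F x \<le> 0" for x
  proof (rule ccontr)
    assume no: "\<not> int_sat ?n sys x"
    have lp: "\<exists>w. sat ?n (sys \<union> C) x w" if "C \<subseteq> B" for C
    proof -
      have "q C \<subseteq> R" using that unfolding R_def by blast
      then have "\<forall>(a, F)\<in>q C. F x \<le> 0" using le by blast
      then show ?thesis using q[OF that] by blast
    qed
    obtain a F where s: "(a, F) \<in> sys" and
      thin: "\<And>w. sat ?n sys x w \<Longrightarrow> lin ?n a w < F x + width (a, F)"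
    proof -
      have "\<exists>(a, F)\<in>sys. \<not> (\<exists>w. sat ?n sys x w \<and>
          F x + real (card sys) * of_rat (\<Sum>j<?n. \<bar>a j\<bar>) \<le> lin ?n a w)"
        using rounding[OF sys(1), of ?n x] no by blast
      then show ?thesis using that unfolding width_def by (auto simp: not_le)
    qed
    have "(a, F) \<in> ?sys"
    proof (rule ccontr)
      assume "(a, F) \<notin> ?sys"
      then have zero: "\<And>j. j < ?n \<Longrightarrow> a j = 0" using s by auto
      obtain w where w: "sat ?n sys x w" using lp[of "{}"] by auto
      then have "F x \<le> lin ?n a w" using s by (auto simp: sat_def)
      moreover have "width (a, F) = 0" using zero by (simp add: width_def)
      ultimately show False using thin[OF w] by simp
    qed
    note rs = r[OF this]
    then have "\<not> (\<forall>t\<in>r (a, F). snd t x < F x + real (nat \<lceil>width (a, F)\<rceil>))" using no by auto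
    then obtain t where t: "t \<in> r (a, F)" "F x + real (nat \<lceil>width (a, F)\<rceil>) \<le> snd t x"
      by (auto simp: not_less)
    then have "{t} \<subseteq> B" using \<open>(a, F) \<in> ?sys\<close> unfolding B_def by blast
    from lp[OF this] obtain w where w: "sat ?n (sys \<union> {t}) x w" by blast
    have "sat ?n sys x w" using w by (simp add: sat_def)
    moreover have "snd t x \<le> lin ?n (fst t) w" by (rule sat_memD[OF w]) simp
    moreover have "lin ?n (fst t) w = lin ?n a w" using rs t(1) by (intro lin_cong) auto
    moreover have "width (a, F) \<le> real (nat \<lceil>width (a, F)\<rceil>)" by linarith
    ultimately show False using thin[of w] t(2) by linarith
  qed
  moreover have "finite R" "R \<subseteq> D" "\<forall>(a, F)\<in>R. \<forall>j<?n. a j = 0"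
  proof -
    have qs: "finite (q C)" "q C \<subseteq> D" "\<forall>(a, F)\<in>q C. \<forall>j<?n. a j = 0" if "C \<in> Pow B" for C
      using q[of C] that by blast+
    show "finite R" unfolding R_def using B(1) qs(1) by simp
    show "R \<subseteq> D" unfolding R_def using qs(2) by (intro UN_least)
    show "\<forall>(a, F)\<in>R. \<forall>j<?n. a j = 0" unfolding R_def using qs(3) by blast
  qed
  ultimately show ?case unfolding refutable_def by blast
qed

section \<open>From mixed-integer systems to Chvatal inequalities\<close>
lemma affine_chvatal_comb:
  assumes "affine_chvatal N F" "affine_chvatal N G" "\<alpha> \<ge> 0" "\<beta> \<ge> 0"
  shows "affine_chvatal N (\<lambda>x. of_rat \<alpha> * F x + of_rat \<beta> * G x)"
proof -
  obtain t u where "chvatal_tree_on N t" "\<forall>x\<in>carrier_vec N. F x = chvatal_fun t x"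
      "chvatal_tree_on N u" "\<forall>x\<in>carrier_vec N. G x = chvatal_fun u x"
    using assms(1,2) by (auto simp: affine_chvatal_def)
  then show ?thesis
    unfolding affine_chvatal_def using assms(3,4) by (intro exI[of _ "Comb \<alpha> t \<beta> u"]) simp
qed

lemma affine_chvatal_ceil:
  assumes "affine_chvatal N F"
  shows "affine_chvatal N (\<lambda>x. of_int \<lceil>F x\<rceil>)"
proof -
  obtain t where "chvatal_tree_on N t" "\<forall>x\<in>carrier_vec N. F x = chvatal_fun t x"
    using assms by (auto simp: affine_chvatal_def)
  then show ?thesis unfolding affine_chvatal_def by (intro exI[of _ "Ceil t"]) simp
qed

text \<open>
  The family \<open>D\<close> of all valid cuts with a Chvatal right-hand side is closed. Its certificates are
  complete by the elimination theorem and sound by validity.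
\<close>
lemma chvatal_description:
  assumes fin: "finite sys"
    and sys: "\<forall>(a, F)\<in>sys. affine_chvatal N F \<and> integral r a"
  shows "\<exists>\<F>. finite \<F> \<and> (\<forall>F\<in>\<F>. affine_chvatal N F) \<and> (\<forall>x. int_sat r sys x \<longleftrightarrow> (\<forall>F\<in>\<F>. F x \<le> 0))"
proof -
  define D where "D = {(a, F). affine_chvatal N F \<and>
    (\<forall>x w. (\<forall>j. w j \<in> \<int>) \<longrightarrow> sat r sys x w \<longrightarrow> F x \<le> lin r a w)}"
  have "comb_closed D"
    unfolding comb_closed_def
  proof (intro allI impI)
    fix a F b G and \<alpha> \<beta> :: rat
    assume "(a, F) \<in> D" "(b, G) \<in> D" and nn: "\<alpha> \<ge> 0" "\<beta> \<ge> 0"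
    then show "((\<lambda>j. \<alpha> * a j + \<beta> * b j), (\<lambda>x. of_rat \<alpha> * F x + of_rat \<beta> * G x)) \<in> D"
      by (auto simp: D_def lin_comb affine_chvatal_comb intro!: add_mono mult_left_mono)
  qed
  moreover have "ceil_closed r D"
    unfolding ceil_closed_def
  proof (intro allI impI)
    fix a F assume aF: "(a, F) \<in> D" and a: "integral r a"
    have "of_int \<lceil>F x\<rceil> \<le> lin r a w" if w: "\<forall>j. w j \<in> \<int>" "sat r sys x w" for x w
    proof -
      have "F x \<le> lin r a w" using aF w by (auto simp: D_def)
      moreover obtain z where "lin r a w = of_int z" using lin_Ints[OF a, of w] w(1) by (auto elim: Ints_cases)
      ultimately show ?thesis by (simp add: ceiling_le_iff)
    qed
    then show "(a, \<lambda>x. of_int \<lceil>F x\<rceil>) \<in> D" using aF by (auto simp: D_def affine_chvatal_ceil)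
  qed
  ultimately have "closed_family r D" by (simp add: closed_family_def)
  moreover have "system_in r D sys"
    using fin sys by (auto simp: system_in_def D_def sat_def)
  ultimately have "refutable r D sys" by (rule integer_elimination)
  then obtain R where R: "finite R" "R \<subseteq> D" "\<forall>(a, F)\<in>R. \<forall>j<r. a j = 0"
      "\<forall>x. (\<forall>(a, F)\<in>R. F x \<le> 0) \<longrightarrow> int_sat r sys x"
    unfolding refutable_def by blast
  show ?thesis
  proof (intro exI[of _ "snd ` R"] conjI allI iffI)
    show "\<forall>F\<in>snd ` R. affine_chvatal N F" using R(2) by (auto simp: D_def)
  next
    fix x assume "int_sat r sys x"
    then obtain w where w: "\<forall>j. w j \<in> \<int>" "sat r sys x w" by (auto simp: int_sat_def)
    show "\<forall>F\<in>snd ` R. F x \<le> 0"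
    proof clarsimp
      fix a F assume aF: "(a, F) \<in> R"
      then have "F x \<le> lin r a w" using R(2) w by (auto simp: D_def)
      also have "lin r a w = 0" using R(3) aF by (intro lin_zero) auto
      finally show "F x \<le> 0" .
    qed
  next
    fix x assume "\<forall>F\<in>snd ` R. F x \<le> 0"
    then show "int_sat r sys x" using R(4) by force
  qed (use R(1) in auto)
qed

lemma common_denominator:
  fixes c :: "nat \<Rightarrow> rat"
  shows "\<exists>m::int. m > 0 \<and> integral r (\<lambda>j. of_int m * c j)"
proof (induction r)
  case 0
  show ?case by (rule exI[of _ 1]) (simp add: integral_def)
next
  case (Suc r)
  then obtain m :: int where m: "m > 0" "integral r (\<lambda>j. of_int m * c j)" by blast
  obtain a b where ab: "c r = Fract a b" "b > 0" by (cases "c r") auto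
  have "of_int b * c r = of_int a" using ab by (simp add: Fract_of_int_quotient)
  then have "of_int (b * m) * c r = of_int (m * a)" by (simp add: algebra_simps)
  moreover have "of_int (b * m) * c j \<in> \<int>" if "j < r" for j
  proof -
    have "of_int m * c j \<in> \<int>" using m(2) that unfolding integral_def by blast
    from Ints_mult[OF Ints_of_int this] have "of_int b * (of_int m * c j) \<in> \<int>" .
    then show ?thesis by (simp add: algebra_simps)
  qed
  ultimately have "integral (Suc r) (\<lambda>j. of_int (b * m) * c j)"
    unfolding integral_def less_Suc_eq by (metis Ints_of_int)
  then show ?case using m(1) ab(2) by (intro exI[of _ "b * m"]) auto
qed

text \<open>
  When the continuous variables are eliminated, both \<open>x\<close> and the integer variables \<open>w\<close> are
  parameters. The sign of \<open>lin r c w\<close> is such that \<open>F (x, w) \<le> 0\<close> is a cut with coefficients \<open>c\<close>.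
\<close>
definition affine_param :: "nat \<Rightarrow> nat \<Rightarrow> (real vec \<times> (nat \<Rightarrow> real) \<Rightarrow> real) \<Rightarrow> bool" where
  "affine_param N r F \<longleftrightarrow> (\<exists>u\<in>carrier_vec N. \<exists>e c. \<forall>x\<in>carrier_vec N. \<forall>w.
     F (x, w) = real_of_rat_vec u \<bullet> x + of_rat e - lin r c w)"

lemma scalar_prod_comb:
  assumes "u \<in> carrier_vec N" "v \<in> carrier_vec N" "x \<in> carrier_vec N"
  shows "real_of_rat_vec (\<alpha> \<cdot>\<^sub>v u + \<beta> \<cdot>\<^sub>v v) \<bullet> x =
    of_rat \<alpha> * (real_of_rat_vec u \<bullet> x) + of_rat \<beta> * (real_of_rat_vec v \<bullet> x)"
  using assms
  by (auto simp: scalar_prod_def of_rat_add of_rat_mult sum_distrib_left sum.distrib[symmetric]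
      algebra_simps intro!: sum.cong)

lemma affine_param_comb:
  assumes "affine_param N r F" "affine_param N r G"
  shows "affine_param N r (\<lambda>t. of_rat \<alpha> * F t + of_rat \<beta> * G t)"
proof -
  obtain u e c where u: "u \<in> carrier_vec N"
      "\<And>x w. x \<in> carrier_vec N \<Longrightarrow> F (x, w) = real_of_rat_vec u \<bullet> x + of_rat e - lin r c w"
    using assms(1) unfolding affine_param_def by blast
  obtain v f d where v: "v \<in> carrier_vec N"
      "\<And>x w. x \<in> carrier_vec N \<Longrightarrow> G (x, w) = real_of_rat_vec v \<bullet> x + of_rat f - lin r d w"
    using assms(2) unfolding affine_param_def by blast
  show ?thesis
    unfolding affine_param_def
  proof (intro bexI exI ballI allI)
    show "\<alpha> \<cdot>\<^sub>v u + \<beta> \<cdot>\<^sub>v v \<in> carrier_vec N" using u v by simp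
    fix x :: "real vec" and w assume x: "x \<in> carrier_vec N"
    show "of_rat \<alpha> * F (x, w) + of_rat \<beta> * G (x, w) = real_of_rat_vec (\<alpha> \<cdot>\<^sub>v u + \<beta> \<cdot>\<^sub>v v) \<bullet> x
        + of_rat (\<alpha> * e + \<beta> * f) - lin r (\<lambda>j. \<alpha> * c j + \<beta> * d j) w"
      unfolding scalar_prod_comb[OF u(1) v(1) x] lin_comb u(2)[OF x] v(2)[OF x]
      by (simp add: of_rat_add of_rat_mult algebra_simps)
  qed
qed

text \<open>
  Rounding applies to integral rows only; multiplication by a common denominator, which is
  positive and hence admissible as an edge label, makes the coefficients of \<open>w\<close> integral.
\<close>
lemma affine_param_integral_cut:
  assumes "affine_param N r F"
  shows "\<exists>t. integral r (fst t) \<and> affine_chvatal N (snd t) \<and>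
    (\<forall>x\<in>carrier_vec N. \<forall>w. F (x, w) \<le> 0 \<longleftrightarrow> snd t x \<le> lin r (fst t) w)"
proof -
  obtain u e c where u: "u \<in> carrier_vec N"
      "\<And>x w. x \<in> carrier_vec N \<Longrightarrow> F (x, w) = real_of_rat_vec u \<bullet> x + of_rat e - lin r c w"
    using assms unfolding affine_param_def by blast
  obtain m :: int where m: "m > 0" "integral r (\<lambda>j. of_int m * c j)" using common_denominator by blast
  let ?G = "chvatal_fun (Scale (of_int m) (Leaf u e))"
  have "affine_chvatal N ?G"
    unfolding affine_chvatal_def using m(1) u(1)
    by (intro exI[of _ "Scale (of_int m) (Leaf u e)"]) auto
  moreover have "F (x, w) \<le> 0 \<longleftrightarrow> ?G x \<le> lin r (\<lambda>j. of_int m * c j) w" if "x \<in> carrier_vec N" for x w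
    unfolding lin_scale u(2)[OF that] using m(1) by simp
  ultimately show ?thesis using m(2) by (intro exI[of _ "(\<lambda>j. of_int m * c j, ?G)"]) auto
qed

text \<open>
  Fourier-Motzkin elimination combines rows linearly, so the inequalities that describe the
  projection are affine in the parameters.
\<close>
lemma continuous_elimination:
  assumes fin: "finite ineqs" and aff: "\<forall>(a, F)\<in>ineqs. affine_param N r F"
  shows "\<exists>sys. finite sys \<and> (\<forall>(a, F)\<in>sys. affine_chvatal N F \<and> integral r a) \<and>
    (\<forall>x\<in>carrier_vec N. \<forall>w. (\<exists>y. sat p ineqs (x, w) y) \<longleftrightarrow> sat r sys x w)"
proof -
  define D where "D = {(a, F). affine_param N r F \<and> (\<forall>t y. sat p ineqs t y \<longrightarrow> F t \<le> lin p a y)}"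
  have "comb_closed D"
    unfolding comb_closed_def
  proof (intro allI impI)
    fix a F b G and \<alpha> \<beta> :: rat
    assume "(a, F) \<in> D" "(b, G) \<in> D" "\<alpha> \<ge> 0" "\<beta> \<ge> 0"
    then show "((\<lambda>j. \<alpha> * a j + \<beta> * b j), (\<lambda>t. of_rat \<alpha> * F t + of_rat \<beta> * G t)) \<in> D"
      by (auto simp: D_def lin_comb affine_param_comb intro!: add_mono mult_left_mono)
  qed
  moreover have "ineqs \<subseteq> D" using aff by (auto simp: D_def satD)
  ultimately obtain R where R: "finite R" "R \<subseteq> D" "\<forall>(a, F)\<in>R. \<forall>j<p. a j = 0"
      "\<forall>t. (\<forall>(a, F)\<in>R. F t \<le> 0) \<longrightarrow> (\<exists>y. sat p ineqs t y)"
    using fourier_motzkin[OF _ fin, of D p] by blast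
  have valid: "(\<exists>y. sat p ineqs t y) \<longleftrightarrow> (\<forall>s\<in>R. snd s t \<le> 0)" for t
  proof
    assume "\<exists>y. sat p ineqs t y"
    then obtain y where y: "sat p ineqs t y" by blast
    show "\<forall>s\<in>R. snd s t \<le> 0"
    proof clarsimp
      fix a F assume aF: "(a, F) \<in> R"
      then have "(a, F) \<in> D" using R(2) by blast
      then have "F t \<le> lin p a y" using y unfolding D_def by blast
      also have "lin p a y = 0" using R(3) aF by (intro lin_zero) auto
      finally show "F t \<le> 0" .
    qed
  next
    assume "\<forall>s\<in>R. snd s t \<le> 0"
    then have "\<forall>(a, F)\<in>R. F t \<le> 0" by auto
    then show "\<exists>y. sat p ineqs t y" using R(4) by blast
  qed
  have "\<forall>s\<in>R. \<exists>t. integral r (fst t) \<and> affine_chvatal N (snd t) \<and>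
    (\<forall>x\<in>carrier_vec N. \<forall>w. snd s (x, w) \<le> 0 \<longleftrightarrow> snd t x \<le> lin r (fst t) w)"
    using R(2) by (intro ballI affine_param_integral_cut) (auto simp: D_def)
  from bchoice[OF this] obtain f where "\<forall>s\<in>R. integral r (fst (f s)) \<and> affine_chvatal N (snd (f s)) \<and>
    (\<forall>x\<in>carrier_vec N. \<forall>w. snd s (x, w) \<le> 0 \<longleftrightarrow> snd (f s) x \<le> lin r (fst (f s)) w)" ..
  then have f: "\<forall>s\<in>R. integral r (fst (f s))" "\<forall>s\<in>R. affine_chvatal N (snd (f s))"
      "\<And>s x w. s \<in> R \<Longrightarrow> x \<in> carrier_vec N \<Longrightarrow> snd s (x, w) \<le> 0 \<longleftrightarrow> snd (f s) x \<le> lin r (fst (f s)) w"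
    by blast+
  show ?thesis
  proof (intro exI[of _ "f ` R"] conjI ballI allI)
    show "case s of (a, F) \<Rightarrow> affine_chvatal N F \<and> integral r a" if "s \<in> f ` R" for s
      using that f(1,2) by (auto simp: case_prod_beta)
    show "(\<exists>y. sat p ineqs (x, w) y) \<longleftrightarrow> sat r (f ` R) x w" if "x \<in> carrier_vec N" for x w
      unfolding valid using f(3)[OF _ that] by (auto simp: sat_def case_prod_beta)
  qed (use R(1) in auto)
qed

lemma milp_as_cuts:
  assumes A: "A \<in> carrier_mat k N" and B: "B \<in> carrier_mat k p" and C: "C \<in> carrier_mat k r"
    and d: "d \<in> carrier_vec k" and x: "x \<in> carrier_vec N"
    and ineqs: "ineqs = (\<lambda>i. (\<lambda>j. B $$ (i, j), \<lambda>(x, w).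
      of_rat (d $ i) - real_of_rat_vec (row A i) \<bullet> x - lin r (\<lambda>j. C $$ (i, j)) w)) ` {..<k}"
  shows "(\<exists>y \<in> carrier_vec p. \<exists>w \<in> carrier_vec r.
            real_of_rat_mat A *\<^sub>v x + real_of_rat_mat B *\<^sub>v y
              + real_of_rat_mat C *\<^sub>v real_of_int_vec w \<ge> real_of_rat_vec d)
    \<longleftrightarrow> (\<exists>w. (\<forall>j. w j \<in> \<int>) \<and> (\<exists>y. sat p ineqs (x, w) y))" (is "?L \<longleftrightarrow> ?R")
proof -
  have key: "real_of_rat_mat A *\<^sub>v x + real_of_rat_mat B *\<^sub>v y
        + real_of_rat_mat C *\<^sub>v real_of_int_vec w \<ge> real_of_rat_vec d
      \<longleftrightarrow> sat p ineqs (x, v) y'"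
    if y: "y \<in> carrier_vec p" "\<And>j. j < p \<Longrightarrow> y' j = y $ j"
      and w: "w \<in> carrier_vec r" "\<And>j. j < r \<Longrightarrow> v j = of_int (w $ j)" for y w y' v
  proof -
    have rowA: "row (real_of_rat_mat A) i = real_of_rat_vec (row A i)" if "i < k" for i
      using A that by (intro eq_vecI) auto
    have By: "row (real_of_rat_mat B) i \<bullet> y = lin p (\<lambda>j. B $$ (i, j)) y'" if "i < k" for i
      using B y that by (auto simp: scalar_prod_def lin_def lessThan_atLeast0 intro!: sum.cong)
    have Cw: "row (real_of_rat_mat C) i \<bullet> real_of_int_vec w = lin r (\<lambda>j. C $$ (i, j)) v" if "i < k" for i
      using C w that by (auto simp: scalar_prod_def lin_def lessThan_atLeast0 intro!: sum.cong)
    show ?thesis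
      unfolding less_eq_vec_def sat_def ineqs using A B C d x
      by (auto simp: rowA By Cw algebra_simps)
  qed
  show ?thesis
  proof
    assume ?L
    then obtain y w where "y \<in> carrier_vec p" "w \<in> carrier_vec r" and
      le: "real_of_rat_mat A *\<^sub>v x + real_of_rat_mat B *\<^sub>v y
        + real_of_rat_mat C *\<^sub>v real_of_int_vec w \<ge> real_of_rat_vec d" by blast
    from le[unfolded key[OF this(1) _ this(2), of "\<lambda>j. y $ j" "\<lambda>j. of_int (w $ j)", simplified]]
    show ?R by (intro exI[of _ "\<lambda>j. of_int (w $ j)"]) auto
  next
    assume ?R
    then obtain v y' where v: "\<forall>j. v j \<in> \<int>" and s: "sat p ineqs (x, v) y'" by blast
    let ?w = "vec r (\<lambda>j. \<lfloor>v j\<rfloor>)" and ?y = "vec p y'"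
    have "v j = of_int \<lfloor>v j\<rfloor>" for j using v by (metis Ints_cases floor_of_int)
    then have "real_of_rat_mat A *\<^sub>v x + real_of_rat_mat B *\<^sub>v ?y
        + real_of_rat_mat C *\<^sub>v real_of_int_vec ?w \<ge> real_of_rat_vec d"
      using s by (subst key[of ?y y' ?w v]) auto
    then show ?L by (intro bexI[of _ ?y] bexI[of _ ?w]) auto
  qed
qed

theorem theorem4p6:
  fixes N :: nat and S :: "real vec set"
  assumes "S \<subseteq> carrier_vec N"
    and "milp_representable N S"
  shows "mic_set N S"
proof -
  obtain p r k A B C d where A: "A \<in> carrier_mat k N" and B: "B \<in> carrier_mat k p"
    and C: "C \<in> carrier_mat k r" and d: "d \<in> carrier_vec k"
    and S: "S = {x \<in> carrier_vec N. \<exists>y \<in> carrier_vec p. \<exists>w \<in> carrier_vec r.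
            real_of_rat_mat A *\<^sub>v x + real_of_rat_mat B *\<^sub>v y
              + real_of_rat_mat C *\<^sub>v real_of_int_vec w \<ge> real_of_rat_vec d}"
    using assms(2) unfolding milp_representable_def by blast
  define ineqs where "ineqs = (\<lambda>i. (\<lambda>j. B $$ (i, j), \<lambda>(x, w).
      of_rat (d $ i) - real_of_rat_vec (row A i) \<bullet> x - lin r (\<lambda>j. C $$ (i, j)) w)) ` {..<k}"
  have "affine_param N r F" if aF: "(a, F) \<in> ineqs" for a F
  proof -
    obtain i where i: "i < k" and F: "F = (\<lambda>(x, w).
        of_rat (d $ i) - real_of_rat_vec (row A i) \<bullet> x - lin r (\<lambda>j. C $$ (i, j)) w)"
      using aF by (auto simp: ineqs_def)
    have "real_of_rat_vec (- row A i) \<bullet> x = - (real_of_rat_vec (row A i) \<bullet> x)"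
      if "x \<in> carrier_vec N" for x
      using A i that by (auto simp: scalar_prod_def of_rat_minus sum_negf)
    then show ?thesis
      unfolding affine_param_def F using A i
      by (intro bexI[of _ "- row A i"] exI[of _ "d $ i"] exI[of _ "\<lambda>j. C $$ (i, j)"]) auto
  qed
  then have aff: "\<forall>(a, F)\<in>ineqs. affine_param N r F" by blast
  have "finite ineqs" by (simp add: ineqs_def)
  from continuous_elimination[OF this aff, of p]
  obtain sys where fin: "finite sys"
    and sys: "\<forall>(a, F)\<in>sys. affine_chvatal N F \<and> integral r a"
    and proj: "\<forall>x\<in>carrier_vec N. \<forall>w. (\<exists>y. sat p ineqs (x, w) y) \<longleftrightarrow> sat r sys x w"
    by (elim exE conjE)
  obtain \<F> where \<F>: "finite \<F>" "\<forall>F\<in>\<F>. affine_chvatal N F"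
      and int_sat: "\<forall>x. int_sat r sys x \<longleftrightarrow> (\<forall>F\<in>\<F>. F x \<le> 0)"
    using chvatal_description[OF fin sys] by (elim exE conjE)
  obtain fs where fs: "set fs = \<F>" using finite_list[OF \<F>(1)] by blast
  have mem: "x \<in> S \<longleftrightarrow> (\<forall>i<length fs. (fs ! i) x \<le> 0)" if x: "x \<in> carrier_vec N" for x
  proof -
    have "x \<in> S \<longleftrightarrow> int_sat r sys x"
      unfolding S int_sat_def using milp_as_cuts[OF A B C d x ineqs_def] bspec[OF proj x] x by simp
    then show ?thesis unfolding int_sat[rule_format] fs[symmetric] by (simp add: all_set_conv_all_nth)
  qed
  have append: "x @\<^sub>v real_of_int_vec z = x" if "z \<in> carrier_vec 0" for x z
    using that by (intro eq_vecI) auto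
  have "S = {x @\<^sub>v real_of_int_vec z | x z. x \<in> carrier_vec N \<and> z \<in> carrier_vec 0 \<and>
          (\<forall>i<length fs. (fs ! i) (x @\<^sub>v real_of_int_vec z) \<le> 0)}" (is "S = ?M")
  proof (rule equalityI; rule subsetI)
    fix x assume xS: "x \<in> S"
    then have x: "x \<in> carrier_vec N" using assms(1) by blast
    have "x = x @\<^sub>v real_of_int_vec (0\<^sub>v 0) \<and> x \<in> carrier_vec N \<and> 0\<^sub>v 0 \<in> carrier_vec 0 \<and>
        (\<forall>i<length fs. (fs ! i) (x @\<^sub>v real_of_int_vec (0\<^sub>v 0)) \<le> 0)"
      unfolding append[OF zero_carrier_vec] using x mem[OF x] xS by simp
    then show "x \<in> ?M" by blast
  next
    fix x assume "x \<in> ?M"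
    then show "x \<in> S" using mem append by auto
  qed
  then show ?thesis
    unfolding mic_set_def using \<F>(2) fs
    by (intro exI[of _ N] exI[of _ 0] exI[of _ "length fs"] exI[of _ "\<lambda>i. fs ! i"] exI[of _ "\<lambda>_. 0"]) auto
qed

end
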